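(* For every prime $p$ and every positive integer $d$, we have $n(\mathbb{Z}_p^d)\le 5d\cdot f(p,d)$.
   Context: A complete digraph on $n$ vertices has, for every two distinct vertices $x,y$, both arcs $(x,y)$ and $(y,x)$ (and no loops). For an Abelian group $(\Gamma,+)$, a $\Gamma$-labelling of a digraph $D$ is a map $w\colon A(D)\to\Gamma$ from its arc set. A directed cycle $C$ with vertices $v_i$, $i\in\mathbb{Z}_\ell$ ($\ell\ge 2$), and arcs $(v_i,v_{i+1})$, $i\in\mathbb{Z}_\ell$, is zero-sum if $\sum_{i=0}^{\ell-1} w(v_i,v_{i+1})=0$ in $\Gamma$ (directed cycles of length $2$, i.e. $x\to y\to x$, are allowed). $n(\Gamma)$ denotes the smallest positive integer $n$ such that every $\Gamma$-labelled complete digraph on $n$ vertices contains a zero-sum directed cycle. For a prime $p$ and $d\in\mathbb{N}$, $f(p,d)$ denotes the smallest positive integer $m$ such that for every collection $B_1,\dots,B_m$ of linear bases of the vector space $\mathbb{Z}_p^d$ over $\mathbb{F}_p$, the multiset union $B_1\cup\dots\cup B_m$ is an additive basis of $\mathbb{Z}_p^d$, i.e. every element of $\mathbb{Z}_p^d$ is the sum of the elements of some (possibly empty) sub-multiset of $B_1\cup\dots\cup B_m$. *)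

theory Defs
  imports "HOL-Analysis.Analysis" "HOL-Library.Multiset" "Berlekamp_Zassenhaus.Finite_Field"
begin

text \<open>A directed cycle in the complete digraph on vertex set {0..<N}: a list of at least 2
  distinct vertices v_0,...,v_(l-1); its arcs are (v_i, v_(i+1 mod l)).\<close>
definition is_dcycle :: "nat \<Rightarrow> nat list \<Rightarrow> bool" where
  "is_dcycle N vs \<longleftrightarrow> length vs \<ge> 2 \<and> distinct vs \<and> set vs \<subseteq> {..<N}"

definition cycle_sum :: "(nat \<Rightarrow> nat \<Rightarrow> 'g::comm_monoid_add) \<Rightarrow> nat list \<Rightarrow> 'g" where
  "cycle_sum w vs = (\<Sum>i<length vs. w (vs ! i) (vs ! ((i + 1) mod length vs)))"

text \<open>A labelling w of the complete digraph on {0..<N} (w x y is the label of arc (x,y), x \<noteq> y)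
  contains a zero-sum directed cycle.\<close>
definition has_zero_sum_cycle :: "nat \<Rightarrow> (nat \<Rightarrow> nat \<Rightarrow> 'g::comm_monoid_add) \<Rightarrow> bool" where
  "has_zero_sum_cycle N w \<longleftrightarrow> (\<exists>vs. is_dcycle N vs \<and> cycle_sum w vs = 0)"

definition n_group :: "'g::ab_group_add itself \<Rightarrow> nat" where
  "n_group (_ :: 'g itself) =
     (LEAST N. N > 0 \<and> (\<forall>w :: nat \<Rightarrow> nat \<Rightarrow> 'g. has_zero_sum_cycle N w))"

definition lin_basis :: "(('p::prime_card) mod_ring ^ 'd) set \<Rightarrow> bool" where
  "lin_basis B \<longleftrightarrow> vec.independent B \<and> vec.span B = UNIV"

definition additive_basis :: "('a::comm_monoid_add) multiset \<Rightarrow> bool" where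
  "additive_basis M \<longleftrightarrow> (\<forall>x. \<exists>S. S \<subseteq># M \<and> sum_mset S = x)"

text \<open>f(p,d), with p = CARD('p) and d = CARD('d).\<close>
definition f_pd :: "'p::prime_card itself \<Rightarrow> 'd::finite itself \<Rightarrow> nat" where
  "f_pd (_ :: 'p itself) (_ :: 'd itself) =
     (LEAST m. m > 0 \<and> (\<forall>B :: nat \<Rightarrow> ('p mod_ring ^ 'd) set.
        (\<forall>i<m. lin_basis (B i)) \<longrightarrow> additive_basis (\<Sum>i<m. mset_set (B i))))"

end

theory Submission
  imports Defs
begin

text \<open>
  For distinct vertices \<open>a, x, b\<close> call \<open>w a x + w x b - w a b\<close> the gain of the detour \<open>a, x, b\<close>. Vertex-disjoint
  detours can be strung together to a directed cycle in which each of them may be switched on or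
  off independently, so a zero-sum cycle exists once the gains of disjoint detours contain
  \<open>m = f(p,d)\<close> bases. A set \<open>R\<close> of vertices on which all gains lie in a subspace \<open>U\<close> of dimension \<open>k\<close> has
  all its cycle sums in \<open>U\<close>, so it is enough to find \<open>m\<close> disjoint bases of \<open>U\<close> among its gains. By induction on \<open>k\<close> this
  works for \<open>|R| \<ge> 5mk\<close>: a matroidal version of Haxell's theorem, applied to the 3-element vertex sets
  of detours, either finds these bases, or yields a proper subspace of dimension \<open>k'\<close> and fewer than
  \<open>5m(k - k')\<close> vertices meeting every detour whose gain lies outside that subspace. The constant is
  \<open>5 = 2 * 3 - 1\<close>, the largest size of a union of two intersecting triples.
\<close>

subsection \<open>Independent matchings in hypergraphs\<close>

locale matroid_closure =
  fixes cl :: "'e set \<Rightarrow> 'e set"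
  assumes cl_extensive: "A \<subseteq> cl A"
    and cl_mono: "A \<subseteq> B \<Longrightarrow> cl A \<subseteq> cl B"
    and cl_idem: "cl (cl A) \<subseteq> cl A"
    and cl_exchange: "e \<in> cl (insert b A) \<Longrightarrow> e \<notin> cl A \<Longrightarrow> b \<in> cl (insert e A)"
begin

definition indep :: "'e set \<Rightarrow> bool" where
  "indep S \<longleftrightarrow> (\<forall>e\<in>S. e \<notin> cl (S - {e}))"

lemma cl_subset_clI: "A \<subseteq> cl B \<Longrightarrow> cl A \<subseteq> cl B"
  using cl_mono cl_idem by blast

lemma indep_mono: "indep S \<Longrightarrow> T \<subseteq> S \<Longrightarrow> indep T"
  unfolding indep_def by (meson Diff_mono cl_mono order_refl subsetD)

lemma indep_insert:
  assumes "indep S" "e \<notin> cl S"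
  shows "indep (insert e S)"
  unfolding indep_def
proof
  fix f assume f: "f \<in> insert e S"
  have "e \<notin> S" using assms(2) cl_extensive by blast
  show "f \<notin> cl (insert e S - {f})"
  proof (cases "f = e")
    case True
    with \<open>e \<notin> S\<close> assms(2) show ?thesis by simp
  next
    case False
    with f have "f \<in> S" by simp
    show ?thesis
    proof
      assume "f \<in> cl (insert e S - {f})"
      moreover have "insert e S - {f} = insert e (S - {f})" using False by blast
      moreover have "f \<notin> cl (S - {f})" using assms(1) \<open>f \<in> S\<close> by (simp add: indep_def)
      ultimately have "e \<in> cl (insert f (S - {f}))" using cl_exchange by metis
      then show False using assms(2) \<open>f \<in> S\<close> by (simp add: insert_absorb)
    qed
  qed
qed

text \<open>A minimal \<open>C\<close> inside \<open>A\<close> spanning \<open>e\<close> forms a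
  circuit with \<open>e\<close>, and it must meet \<open>D\<close>. Deleting such a common element
  \<open>b\<close> from \<open>S\<close> frees \<open>e\<close>: otherwise \<open>S - {b}\<close>
  would span \<open>b\<close> as well, against independence. Hence \<open>e\<close> can replace
  \<open>b\<close>.\<close>

lemma fundamental_circuit:
  assumes S: "indep S" and A: "finite A" "A \<subseteq> S" and e: "e \<in> cl A" "e \<notin> cl (A - D)"
  obtains b where "b \<in> A \<inter> D" "e \<notin> cl (S - {b})"
proof -
  define \<C> where "\<C> = {C. C \<subseteq> A \<and> e \<in> cl C}"
  have "finite \<C>" "\<C> \<noteq> {}" using A e by (auto simp: \<C>_def)
  then obtain C where C: "C \<in> \<C>" and min: "\<And>C'. C' \<in> \<C> \<Longrightarrow> C' \<subseteq> C \<Longrightarrow> C' = C"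
    using finite_has_minimal[of \<C>] by blast
  have "\<not> C \<subseteq> A - D" using C e(2) cl_mono unfolding \<C>_def by blast
  then obtain b where b: "b \<in> C" "b \<in> A \<inter> D" using C unfolding \<C>_def by blast
  have "e \<notin> cl (C - {b})"
    using min[of "C - {b}"] b C unfolding \<C>_def by blast
  moreover have "e \<in> cl (insert b (C - {b}))" using C b by (simp add: \<C>_def insert_absorb)
  ultimately have bcl: "b \<in> cl (insert e (C - {b}))" using cl_exchange by blast
  have "e \<notin> cl (S - {b})"
  proof
    assume "e \<in> cl (S - {b})"
    moreover have "C - {b} \<subseteq> cl (S - {b})" using cl_extensive[of "S - {b}"] C A(2) unfolding \<C>_def by blast
    ultimately have "cl (insert e (C - {b})) \<subseteq> cl (S - {b})" by (intro cl_subset_clI) auto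
    then show False using bcl S b A(2) unfolding indep_def by blast
  qed
  then show thesis using that b by blast
qed

end

section \<open>Hypergraphs with a matroid on their edges\<close>

locale matroid_hypergraph = matroid_closure cl for cl :: "'e set \<Rightarrow> 'e set" +
  fixes E :: "'e set" and V :: "'e \<Rightarrow> 'v set" and r :: nat
  assumes finite_E: "finite E"
    and V_nonempty: "e \<in> E \<Longrightarrow> V e \<noteq> {}"
    and finite_V: "e \<in> E \<Longrightarrow> finite (V e)"
    and card_V_le: "e \<in> E \<Longrightarrow> card (V e) \<le> r"
begin

definition indep_matching :: "'e set \<Rightarrow> bool" where
  "indep_matching S \<longleftrightarrow> S \<subseteq> E \<and> indep S \<and> pairwise (\<lambda>e f. disjnt (V e) (V f)) S"

definition max_matching :: "'e set \<Rightarrow> bool" where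
  "max_matching S \<longleftrightarrow> indep_matching S \<and> (\<forall>S'. indep_matching S' \<longrightarrow> card S' \<le> card S)"

definition blockers :: "'e set \<Rightarrow> 'e \<Rightarrow> 'e set" where
  "blockers S g = {b \<in> S. \<not> disjnt (V b) (V g)}"

definition all_blockers :: "'e set \<Rightarrow> 'e list \<Rightarrow> 'e set" where
  "all_blockers S gs = (\<Union>g\<in>set gs. blockers S g)"

definition cover :: "'e set \<Rightarrow> 'e list \<Rightarrow> 'v set" where
  "cover S gs = (\<Union>g\<in>set gs. V g \<union> (\<Union>b\<in>blockers S g. V b))"

text \<open>The counterpart of an alternating tree in matching theory. Disjointness from the cover
  forces different chain elements to have disjoint sets of blockers, so the size of the cover can be
  charged to the blockers.\<close>

fun chain :: "'e set \<Rightarrow> 'e list \<Rightarrow> bool" where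
  "chain S [] \<longleftrightarrow> True"
| "chain S (g # gs) \<longleftrightarrow> chain S gs \<and> g \<in> E \<and> g \<notin> cl (S - all_blockers S gs) \<and> disjnt (V g) (cover S gs)"

text \<open>Newest element first. In a lexicographically least code, extending a chain or shrinking the
  blockers of one of its elements is impossible; the final entry makes longer chains smaller.\<close>

definition code :: "'e set \<Rightarrow> 'e list \<Rightarrow> nat list" where
  "code S gs = rev (map (\<lambda>g. card (blockers S g)) gs) @ [Suc (card E)]"

lemma all_blockers_Cons: "all_blockers S (g # gs) = blockers S g \<union> all_blockers S gs"
  by (simp add: all_blockers_def)

lemma cover_Cons: "cover S (g # gs) = V g \<union> (\<Union>b\<in>blockers S g. V b) \<union> cover S gs"
  by (simp add: cover_def)

lemma indep_matching_insert:
  assumes "indep_matching S" "e \<in> E" "blockers S e = {}" "e \<notin> cl S"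
  shows "indep_matching (insert e S)"
  using assms unfolding indep_matching_def blockers_def
  by (auto simp: pairwise_insert intro: indep_insert dest: disjnt_sym)

lemma indep_matching_subset: "indep_matching S \<Longrightarrow> T \<subseteq> S \<Longrightarrow> indep_matching T"
  unfolding indep_matching_def by (meson indep_mono order_trans pairwise_subset)

lemma indep_matching_finite: "indep_matching S \<Longrightarrow> finite S"
  unfolding indep_matching_def using finite_E finite_subset by blast

lemma exists_max_matching: "\<exists>S. max_matching S"
proof -
  have "indep_matching {}" by (simp add: indep_matching_def indep_def)
  moreover have "\<forall>S. indep_matching S \<longrightarrow> card S < Suc (card E)"
    using finite_E by (simp add: indep_matching_def card_mono less_Suc_eq_le)
  ultimately show ?thesis
    using ex_has_greatest_nat[of indep_matching "{}" card "Suc (card E)"] by (simp add: max_matching_def)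
qed

section \<open>Chains of edges and their improvement\<close>

lemma chain_in_E: "chain S gs \<Longrightarrow> set gs \<subseteq> E"
  by (induction gs) auto

lemma chain_distinct: "chain S gs \<Longrightarrow> distinct gs"
proof (induction gs)
  case (Cons g gs)
  have "g \<notin> set gs"
  proof
    assume "g \<in> set gs"
    then have "V g \<subseteq> cover S gs" by (auto simp: cover_def)
    then show False using Cons.prems V_nonempty[of g] by (auto simp: disjnt_def)
  qed
  with Cons show ?case by simp
qed simp

lemma chain_suffix: "chain S (hs @ gs) \<Longrightarrow> chain S gs"
  by (induction hs) auto

text \<open>Dropping elements of \<open>S\<close> only shrinks the closures in the chain conditions.
  Adding \<open>e\<close> does not enlarge them, as \<open>e\<close> is spanned even after all
  blockers are removed, where the closure is smallest.\<close>

lemma chain_transfer: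
  assumes "chain S gs"
    and "\<And>f. f \<in> set gs \<Longrightarrow> blockers S' f = blockers S f"
    and "S' \<subseteq> insert e S" "e \<in> cl (S - all_blockers S gs)"
  shows "chain S' gs"
  using assms
proof (induction gs)
  case (Cons g gs)
  have ab: "all_blockers S' gs = all_blockers S gs" and cov: "cover S' gs = cover S gs"
    using Cons.prems(2) by (simp_all add: all_blockers_def cover_def)
  have "S - all_blockers S (g # gs) \<subseteq> S - all_blockers S gs" by (auto simp: all_blockers_Cons)
  then have e: "e \<in> cl (S - all_blockers S gs)" using Cons.prems(4) cl_mono by blast
  have "S' - all_blockers S' gs \<subseteq> cl (S - all_blockers S gs)"
    using e Cons.prems(3) cl_extensive[of "S - all_blockers S gs"] unfolding ab by blast
  then have "cl (S' - all_blockers S' gs) \<subseteq> cl (S - all_blockers S gs)" by (rule cl_subset_clI)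
  moreover have "chain S' gs" using Cons e by auto
  ultimately show ?case using Cons.prems(1) cov by auto
qed simp

text \<open>Shorter suffixes of the chain leave more of \<open>S\<close>, so \<open>e\<close>
  becomes spanned on passing some element \<open>h\<close>, or else \<open>e\<close> could be added
  to \<open>S\<close>. There the circuit of \<open>e\<close> contains a blocker \<open>b\<close> of
  \<open>h\<close>; trading \<open>b\<close> for \<open>e\<close> keeps the matching maximum, and
  \<open>h\<close> loses a blocker.\<close>

lemma unblocked_improves:
  assumes "max_matching S" "chain S gs" "e \<in> E" "blockers S e = {}"
    and "e \<notin> cl (S - all_blockers S gs)" "disjnt (V e) (cover S gs)"
  shows "\<exists>S' hs' h hs. gs = hs' @ h # hs \<and> max_matching S' \<and> chain S' (h # hs) \<and>
      (\<forall>f\<in>set hs. blockers S' f = blockers S f) \<and> card (blockers S' h) < card (blockers S h)"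
  using assms(2,5,6)
proof (induction gs)
  case Nil
  have S: "indep_matching S" using assms(1) by (simp add: max_matching_def)
  have "e \<notin> cl S" using Nil by (simp add: all_blockers_def)
  then have "indep_matching (insert e S)" using indep_matching_insert assms S by blast
  moreover have "e \<notin> S" using \<open>e \<notin> cl S\<close> cl_extensive by blast
  ultimately have "card (insert e S) \<le> card S" "card (insert e S) = Suc (card S)"
    using assms(1) indep_matching_finite[OF S] by (auto simp: max_matching_def)
  then show ?case by simp
next
  case (Cons h hs)
  have S: "indep_matching S" and finS: "finite S"
    using assms(1) indep_matching_finite by (auto simp: max_matching_def)
  show ?case
  proof (cases "e \<in> cl (S - all_blockers S hs)")
    case False
    have "disjnt (V e) (cover S hs)" using Cons.prems(3) by (simp add: cover_Cons)
    moreover have "chain S hs" using Cons.prems(1) by simp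
    ultimately obtain S' hs' h' hs'' where IH: "hs = hs' @ h' # hs''" "max_matching S'"
      "chain S' (h' # hs'')" "\<forall>f\<in>set hs''. blockers S' f = blockers S f"
      "card (blockers S' h') < card (blockers S h')"
      using Cons.IH[OF _ False] by blast
    have "h # hs = (h # hs') @ h' # hs''" using IH(1) by simp
    with IH(2-) show ?thesis by (intro exI[of _ S'] exI[of _ "h # hs'"] exI[of _ h'] exI[of _ hs'']) simp
  next
    case True
    let ?A = "S - all_blockers S hs"
    have "S - all_blockers S (h # hs) = ?A - blockers S h" by (auto simp: all_blockers_Cons)
    then have nin: "e \<notin> cl (?A - blockers S h)" using Cons.prems(2) by simp
    obtain b where b: "b \<in> ?A \<inter> blockers S h" "e \<notin> cl (S - {b})"
    proof (rule fundamental_circuit[of S ?A e "blockers S h"])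
      show "indep S" using S by (simp add: indep_matching_def)
    qed (use finS True nin in auto)
    define S' where "S' = insert e (S - {b})"
    \<comment> \<open>Having a nonempty vertex set, an element of \<open>S\<close> would block
      itself.\<close>
    have "e \<notin> S"
      using assms(3,4) V_nonempty[of e] by (auto simp: blockers_def disjnt_def)
    have "indep_matching S'" unfolding S'_def
      using assms(3,4) b by (intro indep_matching_insert indep_matching_subset[OF S]) (auto simp: blockers_def)
    moreover have "card S' = card S" using b finS \<open>e \<notin> S\<close> card_Suc_Diff1[of S b] by (simp add: S'_def blockers_def)
    ultimately have max: "max_matching S'" using assms(1) by (simp add: max_matching_def)
    have disj: "disjnt (V e) (V f)" if "f \<in> set (h # hs)" for f
      using Cons.prems(3) that by (auto simp: cover_def disjnt_def)
    \<comment> \<open>The set \<open>?A\<close> omits all older blockers, so \<open>b\<close> blocks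
      nothing older than \<open>h\<close>; and \<open>e\<close> meets no chain element, because the
      cover contains their vertices.\<close>
    have blk: "blockers S' f = blockers S f" if "f \<in> set hs" for f
      using disj[of f] that b(1) unfolding S'_def blockers_def all_blockers_def by auto
    have blkh: "blockers S' h = blockers S h - {b}"
      using disj[of h] unfolding S'_def blockers_def by auto
    have chain_hs: "chain S' hs"
      by (rule chain_transfer[of S]) (use Cons.prems(1) blk True in \<open>simp_all add: S'_def subset_insertI2\<close>)
    have ab: "all_blockers S' hs = all_blockers S hs" and cov: "cover S' hs = cover S hs"
      using blk by (simp_all add: all_blockers_def cover_def)
    have "S' - all_blockers S' hs \<subseteq> cl ?A"
    proof -
      have "S' - all_blockers S' hs \<subseteq> insert e ?A" unfolding ab by (auto simp: S'_def)
      also have "\<dots> \<subseteq> cl ?A" using True cl_extensive by simp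
      finally show ?thesis .
    qed
    then have "cl (S' - all_blockers S' hs) \<subseteq> cl ?A" by (rule cl_subset_clI)
    then have "chain S' (h # hs)" using chain_hs Cons.prems(1) cov by auto
    moreover have "card (blockers S' h) < card (blockers S h)"
      unfolding blkh using b finS by (intro card_Diff1_less) (auto simp: blockers_def)
    ultimately show ?thesis
      using max blk by (intro exI[of _ S'] exI[of _ "[]"] exI[of _ h] exI[of _ hs]) simp
  qed
qed

text \<open>A blocker shares a vertex with \<open>g\<close>, so it adds at most \<open>r - 1\<close>
  new ones.\<close>

lemma card_star_le:
  assumes "g \<in> E" "S \<subseteq> E"
  shows "card (V g \<union> (\<Union>b\<in>blockers S g. V b)) \<le> r + (r - 1) * card (blockers S g)"
proof -
  have fin: "finite (blockers S g)" and sub: "blockers S g \<subseteq> E"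
    using assms finite_subset[OF assms(2) finite_E] by (auto simp: blockers_def)
  have "card (V b - V g) \<le> r - 1" if "b \<in> blockers S g" for b
  proof -
    have bE: "b \<in> E" using that sub by blast
    have "V b \<inter> V g \<noteq> {}" using that by (auto simp: blockers_def disjnt_def)
    then have "V b - V g \<subset> V b" by blast
    then have "card (V b - V g) < card (V b)" using finite_V[OF bE] by (rule psubset_card_mono[rotated])
    with card_V_le[OF bE] show ?thesis by simp
  qed
  then have "card (\<Union>b\<in>blockers S g. V b - V g) \<le> (r - 1) * card (blockers S g)"
    using card_UN_le[OF fin, of "\<lambda>b. V b - V g"] sum_bounded_above[of "blockers S g" "\<lambda>b. card (V b - V g)" "r - 1"]
    by (simp add: mult.commute)
  moreover have "V g \<union> (\<Union>b\<in>blockers S g. V b) = V g \<union> (\<Union>b\<in>blockers S g. V b - V g)" by blast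
  ultimately show ?thesis
    using card_Un_le[of "V g" "\<Union>b\<in>blockers S g. V b - V g"] card_V_le[OF assms(1)] by simp
qed

lemma finite_cover: "chain S gs \<Longrightarrow> S \<subseteq> E \<Longrightarrow> finite (cover S gs)"
  unfolding cover_def using chain_in_E[of S gs] finite_V finite_E
  by (auto simp: blockers_def intro!: finite_subset[OF _ finite_E])

text \<open>The stars of the chain elements are counted separately: with \<open>k \<ge> 1\<close>
  blockers a star has at most \<open>r + (r - 1) * k \<le> (2 * r - 1) * k\<close> vertices, and no
  blocker is counted twice.\<close>

lemma card_cover_le:
  assumes "chain S gs" "S \<subseteq> E" "\<And>g. g \<in> set gs \<Longrightarrow> blockers S g \<noteq> {}"
  shows "card (cover S gs) \<le> (2 * r - 1) * card (all_blockers S gs)"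
  using assms(1,3)
proof (induction gs)
  case Nil
  then show ?case by (simp add: cover_def)
next
  case (Cons g gs)
  have g: "g \<in> E" using Cons.prems by simp
  have fin: "finite (blockers S g)" "finite (all_blockers S gs)"
    using finite_subset[OF assms(2) finite_E] by (auto simp: blockers_def all_blockers_def)
  \<comment> \<open>A blocker of an older element has all its vertices in the cover, which
    \<open>g\<close> avoids.\<close>
  have "blockers S g \<inter> all_blockers S gs = {}"
  proof -
    have False if "b \<in> blockers S g" "b \<in> all_blockers S gs" for b
    proof -
      have "V b \<subseteq> cover S gs" using that(2) by (auto simp: all_blockers_def cover_def)
      then show False using that(1) Cons.prems(1) by (auto simp: blockers_def disjnt_def)
    qed
    then show ?thesis by blast
  qed
  then have card: "card (all_blockers S (g # gs)) = card (blockers S g) + card (all_blockers S gs)"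
    using fin by (simp add: all_blockers_Cons card_Un_disjoint)
  have pos: "card (blockers S g) \<ge> 1" using Cons.prems(2)[of g] fin by (simp add: Suc_le_eq card_gt_0_iff)
  have "r \<ge> 1" using card_V_le[OF g] V_nonempty[OF g] finite_V[OF g]
    by (metis One_nat_def Suc_le_eq card_gt_0_iff le_trans)
  have "card (V g \<union> (\<Union>b\<in>blockers S g. V b)) \<le> r * card (blockers S g) + (r - 1) * card (blockers S g)"
    using card_star_le[OF g assms(2)] mult_le_mono2[OF pos, of r] by linarith
  also have "\<dots> = (2 * r - 1) * card (blockers S g)"
    proof -
    have "2 * r - 1 = r + (r - 1)" using \<open>r \<ge> 1\<close> by simp
    then show ?thesis by (simp add: add_mult_distrib)
  qed
  finally have "card (cover S (g # gs)) \<le> (2 * r - 1) * card (blockers S g) + card (cover S gs)"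
    using card_Un_le[of "V g \<union> (\<Union>b\<in>blockers S g. V b)" "cover S gs"] by (simp add: cover_Cons)
  also have "\<dots> \<le> (2 * r - 1) * card (all_blockers S (g # gs))"
    using Cons by (simp add: card add_mult_distrib2)
  finally show ?case .
qed

text \<open>Among all maximum matchings with a chain, take a pair of least code; \<open>X\<close> is
  the part of \<open>S\<close> blocking no chain element and \<open>Z\<close> is the cover. No edge
  prolongs the chain, so edges missing \<open>Z\<close> are spanned by \<open>X\<close>. Every chain
  element has a blocker, so the bound on the cover applies.\<close>

theorem max_matching_cover:
  obtains S X Z where "max_matching S" "X \<subseteq> S" "finite Z" "card Z \<le> (2 * r - 1) * card (S - X)"
    "\<And>e. e \<in> E \<Longrightarrow> disjnt (V e) Z \<Longrightarrow> e \<in> cl X"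
proof -
  define \<S> where "\<S> = {(S, gs). max_matching S \<and> chain S gs}"
  define R where "R = (\<lambda>(S, gs) (S', gs'). (code S gs, code S' gs') \<in> lexord less_than)"
  have "\<S> \<subseteq> Pow E \<times> {gs. set gs \<subseteq> E \<and> distinct gs}"
    using chain_in_E chain_distinct by (auto simp: \<S>_def max_matching_def indep_matching_def)
  then have "finite \<S>"
    by (rule finite_subset) (simp add: finite_E finite_subset_distinct)
  moreover have "\<S> \<noteq> {}"
    using exists_max_matching by (auto simp: \<S>_def intro!: exI[of _ "[]"])
  moreover have "asymp_on \<S> R"
    unfolding R_def by (rule asymp_onI) (auto dest: lexord_asymmetric[OF asym_less_than])
  moreover have "transp_on \<S> R"
    unfolding R_def by (rule transp_onI) (auto elim: lexord_trans[OF _ _ trans_less_than])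
  ultimately obtain s where s: "s \<in> \<S>" "\<And>s'. s' \<in> \<S> \<Longrightarrow> s' \<noteq> s \<Longrightarrow> \<not> R s' s"
    using Finite_Set.bex_min_element[of \<S> R] by blast
  obtain S gs where [simp]: "s = (S, gs)" by fastforce
  have S: "max_matching S" and ch: "chain S gs" using s(1) by (auto simp: \<S>_def)
  have SE: "S \<subseteq> E" using S by (simp add: max_matching_def indep_matching_def)
  have min: "(code S' gs', code S gs) \<notin> lexord less_than" if "max_matching S'" "chain S' gs'" for S' gs'
    using s(2)[of "(S', gs')"] that lexord_irreflexive[of less_than "code S gs"]
    by (cases "(S', gs') = s") (auto simp: \<S>_def R_def)
  have blk: "blockers S g \<noteq> {}" if g: "g \<in> set gs" for g
  proof
    assume empty: "blockers S g = {}"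
    obtain ks hs where gs: "gs = ks @ g # hs" using split_list[OF g] by blast
    have "chain S (g # hs)" using ch chain_suffix gs by blast
    then have "chain S hs" "g \<in> E" "g \<notin> cl (S - all_blockers S hs)" "disjnt (V g) (cover S hs)"
      by simp_all
    then obtain S' hs' h hs'' where h: "hs = hs' @ h # hs''" "max_matching S'" "chain S' (h # hs'')"
      "\<forall>f\<in>set hs''. blockers S' f = blockers S f" "card (blockers S' h) < card (blockers S h)"
      using unblocked_improves[OF S _ _ empty] by blast
    have eq: "map (\<lambda>g. card (blockers S' g)) hs'' = map (\<lambda>g. card (blockers S g)) hs''"
      using h(4) by simp
    \<comment> \<open>Codes list the oldest element first: the two agree on \<open>hs''\<close> and
      then drop at \<open>h\<close>, whatever follows.\<close>
    then have "(code S' (h # hs''), code S gs) \<in> lexord less_than"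
      unfolding code_def gs h(1) using h(5) by (simp add: eq lexord_append_leftI)
    then show False using min h by blast
  qed
  have "e \<in> cl (S - all_blockers S gs)" if "e \<in> E" "disjnt (V e) (cover S gs)" for e
  proof (rule ccontr)
    assume "e \<notin> cl (S - all_blockers S gs)"
    then have "chain S (e # gs)" using ch that by simp
    moreover have "card (blockers S e) \<le> card E"
      using SE finite_E by (intro card_mono) (auto simp: blockers_def)
    then have "(code S (e # gs), code S gs) \<in> lexord less_than"
      by (simp add: code_def lexord_append_leftI)
    ultimately show False using min S by blast
  qed
  moreover have "S - (S - all_blockers S gs) = all_blockers S gs"
    by (auto simp: all_blockers_def blockers_def)
  ultimately show thesis
    using that[of S "S - all_blockers S gs" "cover S gs"] S card_cover_le[OF ch SE blk] finite_cover[OF ch SE]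
    by auto
qed

end

subsection \<open>Detours\<close>

fun arc_sum :: "('v \<Rightarrow> 'v \<Rightarrow> 'g::comm_monoid_add) \<Rightarrow> 'v list \<Rightarrow> 'g" where
  "arc_sum w (u # v # vs) = w u v + arc_sum w (v # vs)"
| "arc_sum w vs = 0"

lemma arc_sum_conv_sum: "arc_sum w vs = (\<Sum>i<length vs - 1. w (vs ! i) (vs ! Suc i))"
proof (induction w vs rule: arc_sum.induct)
  case (1 w u v vs)
  then show ?case by (simp add: sum.lessThan_Suc_shift del: sum.lessThan_Suc)
qed simp_all

lemma cycle_sum_conv_arc_sum:
  assumes "vs \<noteq> []"
  shows "cycle_sum w vs = arc_sum w (vs @ [hd vs])"
proof -
  have "(\<Sum>i<length vs. w (vs ! i) (vs ! ((i + 1) mod length vs)))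
      = (\<Sum>i<length vs. w ((vs @ [hd vs]) ! i) ((vs @ [hd vs]) ! Suc i))"
  proof (rule sum.cong[OF refl])
    fix i assume "i \<in> {..<length vs}"
    then show "w (vs ! i) (vs ! ((i + 1) mod length vs)) = w ((vs @ [hd vs]) ! i) ((vs @ [hd vs]) ! Suc i)"
      using assms by (cases "Suc i = length vs") (auto simp: nth_append hd_conv_nth)
  qed
  then show ?thesis by (simp add: cycle_sum_def arc_sum_conv_sum)
qed

section \<open>Routes with switchable detours\<close>

definition detours :: "'v set \<Rightarrow> ('v \<times> 'v \<times> 'v) set" where
  "detours R = {(a, x, b). {a, x, b} \<subseteq> R \<and> distinct [a, x, b]}"

fun vertices :: "'v \<times> 'v \<times> 'v \<Rightarrow> 'v set" where
  "vertices (a, x, b) = {a, x, b}"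

fun detour_gain :: "('v \<Rightarrow> 'v \<Rightarrow> 'g::ab_group_add) \<Rightarrow> 'v \<times> 'v \<times> 'v \<Rightarrow> 'g" where
  "detour_gain w (a, x, b) = w a x + w x b - w a b"

fun route :: "('v \<times> 'v \<times> 'v) set \<Rightarrow> ('v \<times> 'v \<times> 'v) list \<Rightarrow> 'v list" where
  "route J [] = []"
| "route J ((a, x, b) # gs) = (if (a, x, b) \<in> J then [a, x, b] else [a, b]) @ route J gs"

lemma finite_detours: "finite R \<Longrightarrow> finite (detours R)"
  by (rule finite_subset[of _ "R \<times> R \<times> R"]) (auto simp: detours_def)

lemma vertices_subset: "g \<in> detours R \<Longrightarrow> vertices g \<subseteq> R"
  by (auto simp: detours_def)

lemma card_vertices: "g \<in> detours R \<Longrightarrow> card (vertices g) = 3"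
  by (auto simp: detours_def)

lemma detours_Diff: "detours (R - Z) = {g \<in> detours R. disjnt (vertices g) Z}"
  by (auto simp: detours_def disjnt_def)

lemma hd_route: "hd (route J gs @ [z]) = hd (route {} gs @ [z])"
  by (cases gs) auto

lemma arc_sum_Cons: "vs \<noteq> [] \<Longrightarrow> arc_sum w (u # vs) = w u (hd vs) + arc_sum w vs"
  by (cases vs) auto

text \<open>Both variants of a detour share their end vertices, so the arcs between consecutive
  detours do not depend on \<open>J\<close> and each switch contributes only its own gain. The
  appended \<open>z\<close> serves to close the route to a cycle.\<close>

lemma arc_sum_route:
  fixes w :: "'v \<Rightarrow> 'v \<Rightarrow> 'g::ab_group_add"
  assumes "distinct gs"
  shows "arc_sum w (route J gs @ [z]) = arc_sum w (route {} gs @ [z]) + (\<Sum>g\<in>set gs \<inter> J. detour_gain w g)"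
  using assms
proof (induction gs)
  case (Cons g gs)
  obtain a x b where g: "g = (a, x, b)" by (cases g)
  have "set (g # gs) \<inter> J = (if g \<in> J then insert g (set gs \<inter> J) else set gs \<inter> J)" by auto
  then have "(\<Sum>g\<in>set (g # gs) \<inter> J. detour_gain w g)
      = (if g \<in> J then detour_gain w g else 0) + (\<Sum>g\<in>set gs \<inter> J. detour_gain w g)"
    using Cons.prems by simp
  then show ?case using Cons by (simp add: g arc_sum_Cons hd_route[of J])
qed simp

lemma set_route_subset: "set (route J gs) \<subseteq> (\<Union>g\<in>set gs. vertices g)"
  by (induction J gs rule: route.induct) auto

lemma distinct_route:
  assumes "distinct gs" "set gs \<subseteq> detours R" "pairwise (\<lambda>g h. disjnt (vertices g) (vertices h)) (set gs)"
  shows "distinct (route J gs)"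
  using assms
proof (induction gs)
  case (Cons g gs)
  obtain a x b where g: "g = (a, x, b)" by (cases g)
  have "disjnt (vertices g) (vertices h)" if "h \<in> set gs" for h
    using Cons.prems(1,3) that by (intro pairwiseD[OF Cons.prems(3)]) auto
  then have "vertices g \<inter> set (route J gs) = {}"
    using set_route_subset[of J gs] by (fastforce simp: disjnt_def)
  moreover have "distinct (route J gs)" using Cons by (auto simp: pairwise_insert)
  ultimately show ?case using Cons.prems(2) by (auto simp: g detours_def)
qed simp

text \<open>Start from the cycle with all detours switched off and switch on a set whose gains
  cancel its sum. The condition \<open>sums\<close> quantifies over all cycles in \<open>R\<close>
  because this starting cycle is only built in the proof.\<close>

lemma zero_sum_cycle_of_detours:
  fixes w :: "nat \<Rightarrow> nat \<Rightarrow> 'g::ab_group_add"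
  assumes G: "G \<subseteq> detours R" "G \<noteq> {}" "finite R" "R \<subseteq> {..<N}"
    and disj: "pairwise (\<lambda>g h. disjnt (vertices g) (vertices h)) G"
    and sums: "\<And>vs. vs \<noteq> [] \<Longrightarrow> distinct vs \<Longrightarrow> set vs \<subseteq> R \<Longrightarrow> length vs \<ge> 2 \<Longrightarrow>
      \<exists>J\<subseteq>G. (\<Sum>g\<in>J. detour_gain w g) = - cycle_sum w vs"
  shows "has_zero_sum_cycle N w"
proof -
  have "finite G" using G finite_detours finite_subset by blast
  then obtain gs where gs: "set gs = G" "distinct gs" using finite_distinct_list by blast
  obtain a x b gs' where gs': "gs = (a, x, b) # gs'" using gs(1) G(2) by (cases gs) auto
  have ne: "route J gs \<noteq> []" "length (route J gs) \<ge> 2" "hd (route J gs) = a" for J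
    by (auto simp: gs')
  have "distinct (route J gs)" for J using distinct_route[of gs R J] gs G disj by auto
  moreover have in_R: "set (route J gs) \<subseteq> R" for J
    using set_route_subset[of J gs] gs G(1) vertices_subset[of _ R] by blast
  ultimately have cyc: "is_dcycle N (route J gs)" for J
    using ne G(4) unfolding is_dcycle_def by blast
  obtain J where J: "J \<subseteq> G" "(\<Sum>g\<in>J. detour_gain w g) = - cycle_sum w (route {} gs)"
    using sums[of "route {} gs"] ne(1,2) in_R cyc unfolding is_dcycle_def by blast
  have "cycle_sum w (route J gs) = cycle_sum w (route {} gs) + (\<Sum>g\<in>set gs \<inter> J. detour_gain w g)"
    using ne arc_sum_route[OF gs(2), of w J a] by (simp add: cycle_sum_conv_arc_sum)
  also have "set gs \<inter> J = J" using gs J by blast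
  finally have "cycle_sum w (route J gs) = 0" by (simp add: J(2))
  then show ?thesis using cyc unfolding has_zero_sum_cycle_def by blast
qed

text \<open>On a set where all detour gains vanish modulo \<open>U\<close>, the labelling is modulo \<open>U\<close> the
  coboundary of the potential \<open>\<lambda>a. w r a\<close> for any base point \<open>r\<close>.\<close>

lemma cycle_sum_in_subspace:
  fixes w :: "nat \<Rightarrow> nat \<Rightarrow> 'a::field ^ 'n"
  assumes U: "vec.subspace U" and gain: "\<And>g. g \<in> detours R \<Longrightarrow> detour_gain w g \<in> U"
    and R: "finite R" "card R \<ge> 3"
    and vs: "length vs \<ge> 2" "distinct vs" "set vs \<subseteq> R"
  shows "cycle_sum w vs \<in> U"
proof -
  have tri: "w a x + w x b - w a b \<in> U" if "a \<in> R" "x \<in> R" "b \<in> R" "distinct [a, x, b]" for a x b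
    using gain[of "(a, x, b)"] that by (simp add: detours_def)
  have "card R > 0" using R by simp
  then obtain r where r: "r \<in> R" by (metis card_gt_0_iff ex_in_conv)
  \<comment> \<open>The value \<open>w r r\<close> labels no arc, so the potential at
    \<open>r\<close> is set to 0 separately.\<close>
  define \<phi> where "\<phi> a = (if a = r then 0 else w r a)" for a
  \<comment> \<open>A third vertex \<open>c\<close> exists by \<open>card R \<ge> 3\<close>; in the
    sum of two gains all labels of arcs at \<open>c\<close> cancel.\<close>
  have loop: "w a r + w r a \<in> U" if a: "a \<in> R" "a \<noteq> r" for a
  proof -
    have "card (R - {a, r}) > 0" using R a r by (simp add: card_Diff_subset)
    then obtain c where c: "c \<in> R" "c \<noteq> a" "c \<noteq> r" by (auto simp: card_gt_0_iff)
    have "(w a r + w r c - w a c) + (w r a + w a c - w r c) \<in> U"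
      using tri[of a r c] tri[of r a c] a r c by (intro vec.subspace_add[OF U]) auto
    then show ?thesis by (simp add: algebra_simps)
  qed
  have w: "w a b - (\<phi> b - \<phi> a) \<in> U" if "a \<in> R" "b \<in> R" "a \<noteq> b" for a b
    using tri[of r a b] loop[of a] that r vec.subspace_0[OF U]
    by (cases "a = r"; cases "b = r") (auto simp: \<phi>_def algebra_simps)
  have "(\<Sum>i<length vs. w (vs ! i) (vs ! ((i + 1) mod length vs)) -
      (\<phi> (vs ! ((i + 1) mod length vs)) - \<phi> (vs ! i))) \<in> U"
  proof (intro vec.subspace_sum[OF U] w)
    fix i assume i: "i \<in> {..<length vs}"
    then have l: "(i + 1) mod length vs < length vs" by (intro mod_less_divisor) auto
    show "vs ! i \<in> R" "vs ! ((i + 1) mod length vs) \<in> R" using i l vs(3) nth_mem by auto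
    have "i \<noteq> (i + 1) mod length vs" using i vs(1) by (cases "Suc i = length vs") auto
    then show "vs ! i \<noteq> vs ! ((i + 1) mod length vs)" using i l vs(2) by (simp add: nth_eq_iff_index_eq)
  qed
  \<comment> \<open>A shift around the cycle only permutes the potentials, so their differences sum
    to zero.\<close>
  moreover have "(\<Sum>i<length vs. \<phi> (vs ! ((i + 1) mod length vs))) = (\<Sum>i<length vs. \<phi> (vs ! i))"
  proof -
    have "(\<Sum>i<length vs. \<phi> (vs ! ((i + 1) mod length vs))) = sum_list (map \<phi> (rotate1 vs))"
      by (simp add: sum_list_sum_nth atLeast0LessThan nth_rotate1)
    also have "\<dots> = sum_list (map \<phi> vs)" by (cases vs) (simp_all add: add.commute)
    finally show ?thesis by (simp add: sum_list_sum_nth atLeast0LessThan)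
  qed
  ultimately show ?thesis by (simp add: cycle_sum_def sum_subtractf)
qed

subsection \<open>Additive bases\<close>

text \<open>Distinct detours may have equal gains, so a subsum of a multiset of gains has to be
  traced back to an actual set of detours.\<close>

lemma sub_mset_image_mset_set:
  assumes "finite A" "T \<subseteq># image_mset f (mset_set A)"
  shows "\<exists>J\<subseteq>A. T = image_mset f (mset_set J)"
  using assms
proof (induction A arbitrary: T rule: finite_induct)
  case (insert a A)
  have sub: "T \<subseteq># add_mset (f a) (image_mset f (mset_set A))" using insert.prems insert.hyps by simp
  show ?case
  proof (cases "f a \<in># T")
    case True
    then have "T - {#f a#} \<subseteq># image_mset f (mset_set A)"
      using sub subset_eq_diff_conv[of T "{#f a#}" "image_mset f (mset_set A)"] by simp
    from insert.IH[OF this] obtain J where J: "J \<subseteq> A" "T - {#f a#} = image_mset f (mset_set J)"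
      by (elim exE conjE)
    have "T = add_mset (f a) (image_mset f (mset_set J))" using insert_DiffM[OF True] J(2) by simp
    also have "\<dots> = image_mset f (mset_set (insert a J))"
    proof (subst mset_set.insert)
      show "finite J" using J(1) insert.hyps(1) by (rule finite_subset)
      show "a \<notin> J" using J(1) insert.hyps(2) by blast
    qed simp
    finally show ?thesis using J(1) by (intro exI[of _ "insert a J"]) auto
  next
    case False
    then have "T \<subseteq># image_mset f (mset_set A)"
    proof (intro mset_subset_eqI)
      fix y
      show "count T y \<le> count (image_mset f (mset_set A)) y"
        using mset_subset_eq_count[OF sub, of y] False by (cases "y = f a") (auto simp: not_in_iff)
    qed
    from insert.IH[OF this] obtain J where "J \<subseteq> A" "T = image_mset f (mset_set J)"
      by (elim exE conjE)
    then show ?thesis by (intro exI[of _ J]) auto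
  qed
qed simp

lemma sum_image_mset_set_disjoint:
  fixes m :: nat
  assumes "\<And>i. i < m \<Longrightarrow> finite (L i)" "\<And>i j. i < m \<Longrightarrow> j < m \<Longrightarrow> i \<noteq> j \<Longrightarrow> L i \<inter> L j = {}"
  shows "(\<Sum>i<m. image_mset f (mset_set (L i))) = image_mset f (mset_set (\<Union>i<m. L i))"
  using assms
proof (induction m)
  case (Suc m)
  have "L i \<inter> L m = {}" if "i < m" for i using Suc.prems(2)[of i m] that by simp
  then have "(\<Union>i<m. L i) \<inter> L m = {}" by blast
  moreover have "(\<Union>i<Suc m. L i) = (\<Union>i<m. L i) \<union> L m" by (auto simp: less_Suc_eq)
  ultimately show ?case using Suc by (simp add: mset_set_Union)
qed simp

lemma vec_linear_sum_mset:
  assumes "Vector_Spaces.linear (*s) (*s) (h :: 'a::field ^ 'n \<Rightarrow> 'a ^ 'm)"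
  shows "h (\<Sum>\<^sub># M) = (\<Sum>x\<in>#M. h x)"
proof -
  interpret Vector_Spaces.linear "(*s)" "(*s)" h by (rule assms)
  show ?thesis by (induction M) (simp_all add: add zero)
qed

section \<open>The number \<open>f(p,d)\<close> and its use inside subspaces\<close>

abbreviation bases_additive :: "'p::prime_card itself \<Rightarrow> 'd::finite itself \<Rightarrow> nat \<Rightarrow> bool" where
  "bases_additive _ _ m \<equiv> \<forall>B :: nat \<Rightarrow> ('p mod_ring ^ 'd) set.
     (\<forall>i<m. lin_basis (B i)) \<longrightarrow> additive_basis (\<Sum>i<m. mset_set (B i))"

lemma of_nat_vec_scale: "of_nat n *s (x :: 'a::comm_ring_1 ^ 'n) = of_nat n * x"
  by (simp add: vec_eq_iff of_nat_index)

text \<open>Among sufficiently many bases, one is repeated \<open>CARD('p)\<close> times, and that one alone suffices.\<close>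

lemma exists_bases_additive: "\<exists>m>0. bases_additive TYPE('p::prime_card) TYPE('d::finite) m"
proof -
  define m where "m = CARD('p) * CARD(('p mod_ring ^ 'd) set)"
  have "additive_basis (\<Sum>i<m. mset_set (B i))"
    if B: "\<forall>i<m. lin_basis (B i)" for B :: "nat \<Rightarrow> ('p mod_ring ^ 'd) set"
  proof -
    obtain B0 where B0: "card (B -` {B0} \<inter> {..<m}) * CARD(('p mod_ring ^ 'd) set) \<ge> m"
      using pigeonhole_card[of B "{..<m}" "UNIV :: ('p mod_ring ^ 'd) set set"] by auto
    define I where "I = B -` {B0} \<inter> {..<m}"
    have I: "card I \<ge> CARD('p)" using B0 unfolding I_def m_def by simp
    have "card I > 0" using I zero_less_card_finite[where 'a = 'p] by linarith
    then obtain i where "i \<in> I" by (auto simp: card_gt_0_iff)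
    then have span: "vec.span B0 = UNIV" using B by (auto simp: I_def lin_basis_def)
    show ?thesis unfolding additive_basis_def
    proof
      fix x :: "'p mod_ring ^ 'd"
      obtain u where u: "x = (\<Sum>b\<in>B0. u b *s b)"
      proof -
        have "x \<in> range (\<lambda>u. \<Sum>b\<in>B0. u b *s b)" using span vec.span_finite[of B0] by simp
        then show thesis using that by blast
      qed
      \<comment> \<open>Coefficients lift to natural numbers below \<open>CARD('p)\<close>, so the
        repeated copies of \<open>B0\<close> provide enough of each vector.\<close>
      have "\<exists>n. n < CARD('p) \<and> u b = of_nat n" for b by (rule surj_of_nat_mod_ring)
      then obtain n where n: "\<And>b. n b < CARD('p)" "\<And>b. u b = of_nat (n b)" by metis
      define T where "T = (\<Sum>b\<in>B0. replicate_mset (n b) b)"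
      have "\<Sum>\<^sub># T = x"
      proof -
        have "\<Sum>\<^sub># (\<Sum>b\<in>A. replicate_mset (n b) b) = (\<Sum>b\<in>A. u b *s b)" if "finite A" for A
          using that by (induction A) (simp_all add: n(2) of_nat_vec_scale sum_mset_replicate_mset)
        then show ?thesis by (simp add: T_def u)
      qed
      moreover have "T \<subseteq># (\<Sum>i<m. mset_set (B i))"
      proof (rule mset_subset_eqI)
        fix b
        have "count T b \<le> (if b \<in> B0 then CARD('p) else 0)"
          using n(1)[of b] by (simp add: T_def count_sum sum.delta)
        also have "\<dots> \<le> (\<Sum>i\<in>I. count (mset_set (B i)) b)"
          using I by (simp add: I_def)
        also have "\<dots> \<le> (\<Sum>i<m. count (mset_set (B i)) b)"
          by (intro sum_mono2) (auto simp: I_def)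
        finally show "count T b \<le> count (\<Sum>i<m. mset_set (B i)) b" by (simp add: count_sum)
      qed
      ultimately show "\<exists>S. S \<subseteq># (\<Sum>i<m. mset_set (B i)) \<and> \<Sum>\<^sub># S = x" by blast
    qed
  qed
  moreover have "m > 0" by (simp add: m_def)
  ultimately show ?thesis by blast
qed

lemma f_pd_property:
  "f_pd TYPE('p::prime_card) TYPE('d::finite) > 0 \<and> bases_additive TYPE('p) TYPE('d) (f_pd TYPE('p) TYPE('d))"
  unfolding f_pd_def by (rule LeastI_ex[OF exists_bases_additive])

text \<open>The bases of \<open>U\<close> are completed by one common complement, which is then projected away.\<close>

lemma bases_additive_subspace:
  fixes U :: "('p::prime_card mod_ring ^ 'd::finite) set"
  assumes m: "bases_additive TYPE('p) TYPE('d) m" and U: "vec.subspace U"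
    and S: "\<And>i. i < m \<Longrightarrow> vec.independent (S i)" "\<And>i. i < m \<Longrightarrow> vec.span (S i) = U"
    and x: "x \<in> U"
  shows "\<exists>T. T \<subseteq># (\<Sum>i<m. mset_set (S i)) \<and> \<Sum>\<^sub># T = x"
proof -
  obtain A where A: "A \<subseteq> U" "vec.independent A" "U \<subseteq> vec.span A" "card A = vec.dim U"
    using vec.basis_exists[of U] by blast
  obtain D where D: "A \<subseteq> D" "vec.independent D" "UNIV \<subseteq> vec.span D"
    by (rule vec.maximal_independent_subset_extend[OF subset_UNIV A(2)]) (rule that)
  define C where "C = D - A"
  \<comment> \<open>This is the projection onto \<open>U\<close> along the span of
    \<open>C\<close>.\<close>
  obtain \<pi> :: "'p mod_ring ^ 'd \<Rightarrow> 'p mod_ring ^ 'd"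
    where lin: "Vector_Spaces.linear (*s) (*s) \<pi>" and \<pi>: "\<And>b. b \<in> D \<Longrightarrow> \<pi> b = (if b \<in> A then b else 0)"
    using vec.linear_independent_extend[OF D(2), of "\<lambda>b. if b \<in> A then b else 0"] by blast
  have \<pi>U: "\<pi> u = u" if "u \<in> U" for u
  proof (rule vec.linear_eq_on[OF lin vec.linear_ident, of u A])
    show "u \<in> vec.span A" using that A(3) by blast
    show "\<pi> b = b" if "b \<in> A" for b using \<pi>[of b] that D(1) by auto
  qed
  have \<pi>C: "\<pi> c = 0" if "c \<in> C" for c
    using \<pi>[of c] that by (simp add: C_def)
  have SU: "S i \<subseteq> U" if "i < m" for i using S(2)[OF that] vec.span_superset by blast
  \<comment> \<open>A common element would be both fixed and killed by \<open>\<pi>\<close>, hence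
    0, which no independent set contains.\<close>
  have disj: "S i \<inter> C = {}" if "i < m" for i
  proof -
    have "0 \<notin> D" using D(2) vec.dependent_zero by blast
    moreover have "s = 0" if "s \<in> S i" "s \<in> C" for s
      using \<pi>U[of s] \<pi>C[of s] SU[OF \<open>i < m\<close>] that by auto
    ultimately show ?thesis by (auto simp: C_def)
  qed
  have basis: "lin_basis (S i \<union> C)" if i: "i < m" for i
  proof -
    have "A \<subseteq> vec.span (S i \<union> C)" using A(1) S(2)[OF i] vec.span_mono[of "S i" "S i \<union> C"] by blast
    moreover have "C \<subseteq> vec.span (S i \<union> C)" using vec.span_superset by blast
    ultimately have "D \<subseteq> vec.span (S i \<union> C)" unfolding C_def by blast
    then have span: "UNIV \<subseteq> vec.span (S i \<union> C)" 
      using D(3) vec.span_minimal[OF _ vec.subspace_span, of D] by blast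
    have "card (S i) = vec.dim U" using vec.dim_eq_card_independent[OF S(1)[OF i]] S(2)[OF i] vec.dim_span by metis
    moreover have "card D = vec.dim (UNIV :: ('p mod_ring ^ 'd) set)"
      using vec.basis_card_eq_dim[OF _ D(3) D(2)] by simp
    moreover have "card D = card C + card A" using D(1) by (simp add: C_def card_Diff_subset card_mono)
    ultimately have "card (S i \<union> C) \<le> vec.dim (UNIV :: ('p mod_ring ^ 'd) set)"
      using card_Un_le[of "S i" C] A(4) by linarith
    then have "vec.independent (S i \<union> C)" by (intro vec.card_le_dim_spanning[OF _ span]) auto
    then show ?thesis using span by (auto simp: lin_basis_def)
  qed
  have "additive_basis (\<Sum>i<m. mset_set (S i \<union> C))"
    using m[rule_format, of "\<lambda>i. S i \<union> C"] basis by simp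
  then obtain T where T: "T \<subseteq># (\<Sum>i<m. mset_set (S i \<union> C))" "\<Sum>\<^sub># T = x"
    unfolding additive_basis_def by blast
  let ?M = "\<Sum>i<m. mset_set (S i)" and ?K = "\<Sum>i<m. mset_set C"
  have "(\<Sum>i<m. mset_set (S i \<union> C)) = ?M + ?K"
    using disj by (simp add: mset_set_Union flip: sum.distrib)
  then have K: "T - ?M \<subseteq># ?K" using T(1) by (simp add: subset_eq_diff_conv add.commute)
  \<comment> \<open>The part of \<open>T\<close> beyond \<open>?M\<close> consists of elements of
    \<open>C\<close>, so applying \<open>\<pi>\<close> to the sum leaves only the part inside
    \<open>?M\<close>.\<close>
  have split: "T = (T \<inter># ?M) + (T - ?M)" by (intro multiset_eqI) (simp add: min_def)
  have "y \<in> U" if "y \<in># ?M" for y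
    using that SU by (auto simp: in_Union_mset_iff set_mset_sum)
  then have "(\<Sum>y\<in>#T \<inter># ?M. \<pi> y) = (\<Sum>y\<in>#T \<inter># ?M. y)"
    by (intro arg_cong[of _ _ sum_mset] image_mset_cong) (auto intro!: \<pi>U)
  moreover have "y \<in> C" if "y \<in># T - ?M" for y
    using mset_subset_eqD[OF K that] by (auto simp: set_mset_sum split: if_splits)
  then have "(\<Sum>y\<in>#T - ?M. \<pi> y) = 0"
    using \<pi>C by (intro sum_mset.neutral) auto
  moreover have "x = (\<Sum>y\<in>#T. \<pi> y)"
    using \<pi>U[OF x] vec_linear_sum_mset[OF lin, of T] T(2) by simp
  ultimately have "\<Sum>\<^sub># (T \<inter># ?M) = x"
    using arg_cong[OF split, of "\<lambda>T. \<Sum>y\<in>#T. \<pi> y"] by simp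
  then show ?thesis by (intro exI[of _ "T \<inter># ?M"]) simp
qed

subsection \<open>Direct sums of linear matroids\<close>

definition layer :: "('e \<times> nat) set \<Rightarrow> nat \<Rightarrow> 'e set" where
  "layer A j = {e. (e, j) \<in> A}"

text \<open>The closure of the direct sum of copies of the linear matroid of \<open>v\<close>, one per layer: an
  independent set holds one candidate basis in each layer.\<close>

definition layered_span :: "('e \<Rightarrow> 'a::field ^ 'n) \<Rightarrow> ('e \<times> nat) set \<Rightarrow> ('e \<times> nat) set" where
  "layered_span v A = {(e, j). v e \<in> vec.span (v ` layer A j)}"

text \<open>Adding an element of layer \<open>j\<close> alters no span in the other layers, so
  exchange reduces to Steinitz exchange within one layer.\<close>

lemma matroid_closure_layered_span:
  fixes v :: "'e \<Rightarrow> 'a::field ^ 'n"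
  shows "matroid_closure (layered_span v)"
proof
  fix A B :: "('e \<times> nat) set" and e b :: "'e \<times> nat"
  show "A \<subseteq> layered_span v A"
    by (auto simp: layered_span_def layer_def intro!: vec.span_base)
  show "layered_span v A \<subseteq> layered_span v B" if "A \<subseteq> B"
  proof -
    have "v ` layer A j \<subseteq> v ` layer B j" for j using that by (auto simp: layer_def)
    then show ?thesis unfolding layered_span_def using vec.span_mono by blast
  qed
  have "v ` layer (layered_span v A) j \<subseteq> vec.span (v ` layer A j)" for j
    by (auto simp: layered_span_def layer_def)
  then have "vec.span (v ` layer (layered_span v A) j) \<subseteq> vec.span (v ` layer A j)" for j
    by (intro vec.span_minimal) auto
  then show "layered_span v (layered_span v A) \<subseteq> layered_span v A"
    unfolding layered_span_def[of v "layered_span v A"] by (auto simp: layered_span_def[of v A])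
  assume *: "e \<in> layered_span v (insert b A)" "e \<notin> layered_span v A"
  obtain f i c j where [simp]: "e = (f, i)" "b = (c, j)" by fastforce
  have "i = j"
  proof (rule ccontr)
    assume "i \<noteq> j"
    then have "layer (insert b A) i = layer A i" by (auto simp: layer_def)
    then show False using * by (simp add: layered_span_def)
  qed
  moreover have "layer (insert (g, j) A) j = insert g (layer A j)" for g by (auto simp: layer_def)
  ultimately show "b \<in> layered_span v (insert e A)"
    using * vec.in_span_insert by (auto simp: layered_span_def)
qed

text \<open>Two elements of one layer with equal vectors would span each other, so passing from
  detours to their gains loses nothing within a layer.\<close>

lemma layered_span_indep:
  assumes "matroid_closure.indep (layered_span v) S"
  shows "inj_on v (layer S j)" "vec.independent (v ` layer S j)"
proof -
  have notin: "v e \<notin> vec.span (v ` (layer S j - {e}))" if "e \<in> layer S j" for e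
  proof -
    have "layer (S - {(e, j)}) j = layer S j - {e}" by (auto simp: layer_def)
    then show ?thesis using assms that by (auto simp: matroid_closure.indep_def[OF matroid_closure_layered_span] layered_span_def layer_def)
  qed
  show inj: "inj_on v (layer S j)"
  proof (rule inj_onI, rule ccontr)
    fix e f assume "e \<in> layer S j" "f \<in> layer S j" "v e = v f" "e \<noteq> f"
    then show False using notin[of e] vec.span_base[of "v f" "v ` (layer S j - {e})"] by auto
  qed
  show "vec.independent (v ` layer S j)"
    unfolding vec.dependent_def
  proof
    assume "\<exists>a\<in>v ` layer S j. a \<in> vec.span (v ` layer S j - {a})"
    then obtain e where e: "e \<in> layer S j" "v e \<in> vec.span (v ` layer S j - {v e})" by blast
    have "v ` layer S j - {v e} = v ` (layer S j - {e})"
      using inj e(1) by (auto simp: inj_on_def)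
    then show False using e notin by simp
  qed
qed

lemma card_layers:
  assumes "finite S" "S \<subseteq> A \<times> {..<m}"
  shows "card S = (\<Sum>j<m. card (layer S j))"
proof -
  have "S = (SIGMA j:{..<m}. layer S j)\<inverse>" using assms(2) by (auto simp: layer_def)
  then have "card S = card (SIGMA j:{..<m}. layer S j)" by (metis card_inverse)
  also have "\<dots> = (\<Sum>j<m. card (layer S j))"
    using assms by (subst card_SigmaI) (auto simp: layer_def intro!: finite_subset[OF _ finite_imageI[of S fst]] image_eqI)
  finally show ?thesis .
qed

subsection \<open>Zero-sum cycles\<close>

lemma finite_layer: "finite S \<Longrightarrow> finite (layer S j)"
  unfolding layer_def by (rule finite_subset[of _ "fst ` S"]) force+

text \<open>The bound \<open>card R \<ge> 3\<close> is stated separately because the linear bound is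
  void in dimension 0, while \<open>cycle_sum_in_subspace\<close> asks for a third vertex.\<close>

lemma zero_sum_cycle_in_subspace:
  fixes w :: "nat \<Rightarrow> nat \<Rightarrow> 'p::prime_card mod_ring ^ 'd::finite"
  assumes m: "m > 0" "bases_additive TYPE('p) TYPE('d) m"
    and "vec.subspace U" "finite R" "R \<subseteq> {..<N}" "card R \<ge> 3" "card R \<ge> 5 * m * vec.dim U"
    and "\<And>g. g \<in> detours R \<Longrightarrow> detour_gain w g \<in> U"
  shows "has_zero_sum_cycle N w"
  using assms(3-)
proof (induction "vec.dim U" arbitrary: U R rule: less_induct)
  case (less U R)
  note U = less.prems(1) and R = less.prems(2-5) and gain = less.prems(6)
  let ?v = "detour_gain w" and ?k = "vec.dim U"
  have cycle_U: "cycle_sum w vs \<in> U" if "length vs \<ge> 2" "distinct vs" "set vs \<subseteq> R" for vs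
    by (rule cycle_sum_in_subspace[OF U gain R(1,3) that])
  show ?case
  proof (cases "?k = 0")
    case True
    \<comment> \<open>Here \<open>U\<close> is trivial, so every cycle sum vanishes and any 2-cycle
      will do.\<close>
    obtain a b where ab: "a \<in> R" "b \<in> R" "a \<noteq> b"
      using R(3) card_le_Suc0_iff_eq[OF R(1)] by force
    then have "cycle_sum w [a, b] \<in> U" by (intro cycle_U) auto
    then have "cycle_sum w [a, b] = 0" using True by auto
    moreover have "is_dcycle N [a, b]" using ab R(2) by (auto simp: is_dcycle_def)
    ultimately show ?thesis unfolding has_zero_sum_cycle_def by blast
  next
    case False
    \<comment> \<open>An edge is a detour together with the index of the basis it is meant for.
      Copies of one detour share their vertices, so a matching contains at most one of them.\<close>
    let ?E = "detours R \<times> {..<m}"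
    interpret matroid_closure "layered_span ?v" by (rule matroid_closure_layered_span)
    interpret matroid_hypergraph "layered_span ?v" ?E "vertices \<circ> fst" 3
    proof
      show "finite ?E" using finite_detours[OF R(1)] by simp
      fix e assume "e \<in> ?E"
      then have "card ((vertices \<circ> fst) e) = 3" using card_vertices[of "fst e" R] by auto
      then show "(vertices \<circ> fst) e \<noteq> {}" "finite ((vertices \<circ> fst) e)" "card ((vertices \<circ> fst) e) \<le> 3"
        by (auto intro: card_ge_0_finite simp del: o_apply)
    qed
    obtain S X Z where max: "max_matching S" and XS: "X \<subseteq> S" and Z: "finite Z" "card Z \<le> 5 * card (S - X)"
      and cov: "\<And>e. e \<in> ?E \<Longrightarrow> disjnt ((vertices \<circ> fst) e) Z \<Longrightarrow> e \<in> layered_span ?v X"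
      by (rule max_matching_cover) auto
    have S: "S \<subseteq> ?E" "indep S" "pairwise (\<lambda>e f. disjnt ((vertices \<circ> fst) e) ((vertices \<circ> fst) f)) S"
      and finS: "finite S"
      using max indep_matching_finite by (auto simp: max_matching_def indep_matching_def)
    have indX: "indep X" using S(2) XS by (rule indep_mono)
    have XE: "X \<subseteq> ?E" and finX: "finite X" using XS S(1) finS finite_subset by blast+
    have layerU: "?v ` layer S j \<subseteq> U" for j
      using S(1) gain by (auto simp: layer_def)
    have card_layer: "card (layer Y j) = vec.dim (?v ` layer Y j)" if "indep Y" for Y j
      using layered_span_indep[OF that, of j] vec.dim_eq_card_independent card_image by metis
    have card_S: "card (layer S j) \<le> ?k" for j
      using card_layer[OF S(2)] vec.dim_subset[OF layerU] by simp
    show ?thesis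
    proof (cases "\<forall>j<m. card (layer S j) = ?k")
      case True
      let ?G = "\<Union>j<m. layer S j"
      have span: "vec.span (?v ` layer S j) = U" if "j < m" for j
      proof -
        have "vec.span (?v ` layer S j) = vec.span U"
          using layerU by (rule vec.dim_eq_span) (use card_layer[OF S(2), of j] True that in simp)
        then show ?thesis using U by (simp add: vec.span_eq_iff)
      qed
      have vert: "vertices e \<noteq> {}" for e :: "nat \<times> nat \<times> nat" by (cases e) auto
      have disjv: "disjnt (vertices e) (vertices f)" if "(e, i) \<in> S" "(f, j) \<in> S" "(e, i) \<noteq> (f, j)" for e f i j
        using pairwiseD[OF S(3) that] by simp
      have layers_disj: "layer S i \<inter> layer S j = {}" if "i \<noteq> j" for i j
        using disjv[of _ i _ j] vert that by (fastforce simp: layer_def disjnt_def)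
      show ?thesis
      proof (rule zero_sum_cycle_of_detours[of ?G R])
        show "?G \<subseteq> detours R" using S(1) by (auto simp: layer_def)
        have "card (layer S 0) \<noteq> 0" using True m(1) False by simp
        then have "layer S 0 \<noteq> {}" by auto
        then show "?G \<noteq> {}" using m(1) by blast
        show "pairwise (\<lambda>g h. disjnt (vertices g) (vertices h)) ?G"
          unfolding pairwise_def by (auto simp: layer_def intro!: disjv simp del: split_paired_All)
        fix vs :: "nat list"
        assume vs: "distinct vs" "set vs \<subseteq> R" "length vs \<ge> 2"
        have "- cycle_sum w vs \<in> U" using cycle_U vs vec.subspace_neg[OF U] by blast
        then obtain T where T: "T \<subseteq># (\<Sum>j<m. mset_set (?v ` layer S j))" "\<Sum>\<^sub># T = - cycle_sum w vs"
          using bases_additive_subspace[OF m(2) U, of "\<lambda>j. ?v ` layer S j"] span layered_span_indep(2)[OF S(2)]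
          by blast
        have "(\<Sum>j<m. mset_set (?v ` layer S j)) = (\<Sum>j<m. image_mset ?v (mset_set (layer S j)))"
          using layered_span_indep(1)[OF S(2)] by (simp add: image_mset_mset_set)
        also have "\<dots> = image_mset ?v (mset_set ?G)"
          using layers_disj finite_layer[OF finS] by (intro sum_image_mset_set_disjoint)
        finally obtain J where J: "J \<subseteq> ?G" "T = image_mset ?v (mset_set J)"
          using sub_mset_image_mset_set[of ?G T ?v] T(1) finite_layer[OF finS] by auto
        then have "(\<Sum>g\<in>J. ?v g) = - cycle_sum w vs"
          using T(2) by (simp add: sum_unfold_sum_mset)
        then show "\<exists>J\<subseteq>?G. (\<Sum>g\<in>J. ?v g) = - cycle_sum w vs" using J(1) by blast
      qed (use R in auto)
    next
      case False
      then obtain i where i: "i < m" "card (layer S i) < ?k" using card_S by (meson le_neq_implies_less)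
      have "card S < m * ?k"
      proof -
        have "card S = (\<Sum>j<m. card (layer S j))" by (rule card_layers[OF finS S(1)])
        also have "\<dots> < (\<Sum>j<m. ?k)" using i card_S by (intro sum_strict_mono_ex1) auto
        finally show ?thesis by simp
      qed
      \<comment> \<open>A detour missing \<open>Z\<close> has its copies in all layers spanned by
        \<open>X\<close>, so any layer would do; the smallest one has at most the average size
        \<open>card X / m\<close>, which bounds the new dimension.\<close>
      obtain j where j: "j < m" "\<And>i. i < m \<Longrightarrow> card (layer X j) \<le> card (layer X i)"
        using ex_min_if_finite[of "(\<lambda>j. card (layer X j)) ` {..<m}"] m(1)
        by (fastforce simp: not_less)
      define U' where "U' = vec.span (?v ` layer X j)"
      have dimU': "vec.dim U' = card (layer X j)"
        using card_layer[OF indX] by (simp add: U'_def)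
      have "m * vec.dim U' = (\<Sum>i<m. card (layer X j))" by (simp add: dimU')
      also have "\<dots> \<le> (\<Sum>i<m. card (layer X i))" using j(2) by (intro sum_mono) auto
      also have "\<dots> = card X" by (rule card_layers[OF finX XE, symmetric])
      finally have mX: "m * vec.dim U' \<le> card X" .
      have XleS: "card X \<le> card S" using XS finS by (rule card_mono[rotated])
      \<comment> \<open>The strict inequality \<open>card S < m * ?k\<close> is worth 5 spare
        vertices, which provide the three vertices required for \<open>R - Z\<close> even if
        \<open>U'\<close> has dimension 0.\<close>
      have cardZ: "card Z + 5 * (m * vec.dim U') + 5 \<le> 5 * (m * ?k)"
        using Z(2) mX XleS \<open>card S < m * ?k\<close> by (simp add: card_Diff_subset[OF finX XS])
      have "card R - card Z \<le> card (R - Z)" using Z(1) by (rule diff_card_le_card_Diff)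
      then have R': "5 * (m * vec.dim U') + 5 \<le> card (R - Z)"
        using cardZ R(4) by (simp add: mult.assoc)
      show ?thesis
      proof (rule less.hyps[of U' "R - Z"])
        have "m * vec.dim U' < m * ?k" using mX XleS \<open>card S < m * ?k\<close> by linarith
        then show "vec.dim U' < ?k" by simp
        show "vec.subspace U'" by (simp add: U'_def)
        show "?v g \<in> U'" if "g \<in> detours (R - Z)" for g
          using cov[of "(g, j)"] that j(1) by (simp add: detours_Diff layered_span_def U'_def)
      qed (use R R' in \<open>auto simp: mult.assoc\<close>)
    qed
  qed
qed

theorem theorem1:
  shows "n_group TYPE(('p::prime_card) mod_ring ^ ('d::finite))
           \<le> 5 * CARD('d) * f_pd TYPE('p) TYPE('d)"
proof -
  let ?f = "f_pd TYPE('p) TYPE('d)"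
  let ?N = "5 * CARD('d) * ?f"
  have d: "CARD('d) > 0" by simp
  have f: "?f > 0" and B: "bases_additive TYPE('p) TYPE('d) ?f" using f_pd_property by auto
  have "has_zero_sum_cycle ?N w" for w :: "nat \<Rightarrow> nat \<Rightarrow> 'p mod_ring ^ 'd"
  \<comment> \<open>For the whole space the condition on gains is trivial, and its dimension
    \<open>CARD('d)\<close> turns the linear bound into \<open>?N\<close>.\<close>
  proof (rule zero_sum_cycle_in_subspace[OF f B, of UNIV "{..<?N}"])
    have "1 \<le> CARD('d) * ?f" using d f by simp
    then have "3 \<le> 5 * (CARD('d) * ?f)" by linarith
    then show "3 \<le> card {..<?N}" by (simp only: card_lessThan mult.assoc)
    have "vec.dim (UNIV :: ('p mod_ring ^ 'd) set) = CARD('d)"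
      by (simp add: card_cart_basis)
    then show "5 * ?f * vec.dim (UNIV :: ('p mod_ring ^ 'd) set) \<le> card {..<?N}"
      by (simp add: mult.commute mult.left_commute)
  qed auto
  moreover have "?N > 0" using d f by simp
  ultimately show ?thesis unfolding n_group_def by (intro Least_le) blast
qed

end
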